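(* Let $s,t$ be real numbers and let $\alpha=\min\{s,t\}$. For $x\in(-\alpha,\infty)$ define $$\Delta_{s,t}(x)=\begin{cases}\left[\dfrac{\psi(x+t)-\psi(x+s)}{t-s}\right]^2+\dfrac{\psi'(x+t)-\psi'(x+s)}{t-s},& s\ne t,\\[1em] [\psi'(x+s)]^2+\psi''(x+s),& s=t,\end{cases}$$ and $$\Theta_{s,t}(x)=[\psi(x+t)-\psi(x+s)]^2+(t-s)[\psi'(x+t)-\psi'(x+s)].$$ Then: (i) if $|t-s|<1$, the function $\Delta_{s,t}$ is completely monotonic on $(-\alpha,\infty)$, and if $|t-s|>1$, the function $-\Delta_{s,t}$ is completely monotonic on $(-\alpha,\infty)$; (ii) if $|t-s|<1$, the function $\Theta_{s,t}$ is completely monotonic on $(-\alpha,\infty)$, and if $|t-s|>1$, the function $-\Theta_{s,t}$ is completely monotonic on $(-\alpha,\infty)$.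
   Context: $\Gamma(x)=\int_0^\infty u^{x-1}e^{-u}\,du$ for $x>0$ is the Euler gamma function, $\psi(x)=\Gamma'(x)/\Gamma(x)$ is the psi (digamma) function on $(0,\infty)$, and $\psi',\psi''$ are its first and second derivatives. A function $f$ is completely monotonic on an interval $I$ if $f$ has derivatives of all orders on $I$ and $(-1)^n f^{(n)}(x)\ge 0$ for all $x\in I$ and all integers $n\ge 0$. *)

theory Defs
  imports "HOL-Analysis.Analysis"
begin

text \<open>
  The sequence \<open>D\<close> consists of the successive derivatives of \<open>f\<close> on \<open>I\<close>. Derivatives are taken
  within \<open>I\<close>, hence one-sided at an endpoint that belongs to \<open>I\<close>; \<open>I\<close> is meant to be a
  non-degenerate interval, so that they are unique.
\<close>
definition completely_monotonic_on :: "real set \<Rightarrow> (real \<Rightarrow> real) \<Rightarrow> bool" where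
  "completely_monotonic_on I f \<longleftrightarrow>
     (\<exists>D :: nat \<Rightarrow> real \<Rightarrow> real.
        (\<forall>x\<in>I. D 0 x = f x) \<and>
        (\<forall>n. \<forall>x\<in>I. (D n has_real_derivative D (Suc n) x) (at x within I)) \<and>
        (\<forall>n. \<forall>x\<in>I. (-1) ^ n * D n x \<ge> 0))"

lemma completely_monotonic_on_open_iff:
  assumes "open I"
  shows "completely_monotonic_on I f \<longleftrightarrow>
           (\<forall>n. \<forall>x\<in>I. (deriv ^^ n) f differentiable (at x) \<and> (-1) ^ n * (deriv ^^ n) f x \<ge> 0)"
    (is "?L \<longleftrightarrow> ?R")
proof
  assume ?L
  then obtain D :: "nat \<Rightarrow> real \<Rightarrow> real" where D: "\<forall>x\<in>I. D 0 x = f x"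
      "\<forall>n. \<forall>x\<in>I. (D n has_real_derivative D (Suc n) x) (at x within I)"
      "\<forall>n. \<forall>x\<in>I. (-1) ^ n * D n x \<ge> 0"
    unfolding completely_monotonic_on_def by blast
  have D0: "D 0 x = f x" if "x \<in> I" for x
    using D(1) that by blast
  have DS: "(D n has_real_derivative D (Suc n) x) (at x)" if "x \<in> I" for n x
    using D(2) that at_within_open[OF that assms] by metis
  have Dpos: "(-1) ^ n * D n x \<ge> 0" if "x \<in> I" for n x
    using D(3) that by blast
  have step: "((deriv ^^ n) f has_real_derivative D (Suc n) x) (at x)"
    if "\<And>y. y \<in> I \<Longrightarrow> (deriv ^^ n) f y = D n y" "x \<in> I" for n x
    by (rule has_field_derivative_transform_within_open[OF DS[OF that(2)] assms that(2)])
       (simp add: that(1))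
  have eq: "(deriv ^^ n) f x = D n x" if "x \<in> I" for n x
    using that
  proof (induction n arbitrary: x)
    case (Suc n)
    have "((deriv ^^ n) f has_real_derivative D (Suc n) x) (at x)"
      by (rule step) (use Suc in auto)
    then show ?case by (simp add: DERIV_imp_deriv)
  qed (simp add: D0)
  show ?R
  proof (intro allI ballI conjI)
    fix n x assume x: "x \<in> I"
    have "((deriv ^^ n) f has_real_derivative D (Suc n) x) (at x)"
      by (rule step) (use eq x in auto)
    then show "(deriv ^^ n) f differentiable (at x)"
      using real_differentiable_def by blast
    show "(-1) ^ n * (deriv ^^ n) f x \<ge> 0"
      using Dpos[OF x] eq[OF x] by simp
  qed
next
  assume R: ?R
  have "((deriv ^^ n) f has_real_derivative (deriv ^^ Suc n) f x) (at x within I)" if "x \<in> I" for n x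
  proof -
    have "((deriv ^^ n) f has_real_derivative deriv ((deriv ^^ n) f) x) (at x)"
      using R that DERIV_deriv_iff_real_differentiable by blast
    then show ?thesis by (simp add: has_field_derivative_at_within)
  qed
  moreover have "(-1) ^ n * (deriv ^^ n) f x \<ge> 0" if "x \<in> I" for n x
    using R that by blast
  ultimately show ?L
    unfolding completely_monotonic_on_def
    by (intro exI[of _ "\<lambda>n. (deriv ^^ n) f"] conjI allI ballI) (simp_all only: funpow_0)
qed

text \<open>
  On the positive reals, the library's \<^const>\<open>Digamma\<close>, which is defined by a series, is the
  logarithmic derivative of \<^const>\<open>Gamma\<close>.
\<close>
lemma Digamma_eq_deriv_Gamma:
  fixes x :: real
  assumes "x > 0"
  shows "Digamma x = deriv Gamma x / Gamma x"
proof -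
  have x: "x \<notin> \<int>\<^sub>\<le>\<^sub>0" using assms by (auto elim!: nonpos_Ints_cases)
  then have "deriv Gamma x = Gamma x * Digamma x"
    by (intro DERIV_imp_deriv has_field_derivative_Gamma)
  with Gamma_real_pos[OF assms] show ?thesis by simp
qed

definition Delta :: "real \<Rightarrow> real \<Rightarrow> real \<Rightarrow> real" where
  "Delta s t x =
     (if s \<noteq> t then
        ((Digamma (x + t) - Digamma (x + s)) / (t - s))\<^sup>2
          + (deriv Digamma (x + t) - deriv Digamma (x + s)) / (t - s)
      else (deriv Digamma (x + s))\<^sup>2 + deriv (deriv Digamma) (x + s))"

definition Theta :: "real \<Rightarrow> real \<Rightarrow> real \<Rightarrow> real" where
  "Theta s t x =
     (Digamma (x + t) - Digamma (x + s))\<^sup>2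
       + (t - s) * (deriv Digamma (x + t) - deriv Digamma (x + s))"

end

theory Submission
  imports Defs
begin

text \<open>
  If all derivatives of \<open>f\<close> tend to \<open>0\<close> at infinity and \<open>\<lambda>x. f x - f (x + 1)\<close> is completely
  monotonic, then so is \<open>f\<close>. This principle is applied twice. Let \<open>\<phi>\<close> be the divided difference of
  the digamma function, so that \<open>Delta s t = \<phi>\<^sup>2 + \<phi>'\<close> and \<open>\<phi> (x + 1) = \<phi> x - c x\<close> with
  \<open>c x = 1 / ((x + s) * (x + t))\<close>. Then \<open>Delta s t x - Delta s t (x + 1) = c x * g x\<close>, where
  \<open>g x = 2 * \<phi> x - c x - 1 / (x + s) - 1 / (x + t)\<close>, and
  \<open>g x - g (x + 1) = (1 - (t - s)\<^sup>2) * c x * c (x + 1)\<close>. So the sign of \<open>1 - (t - s)\<^sup>2\<close> decides.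
\<close>

section \<open>Function classes closed under sums and products, and their derivative chains\<close>

text \<open>
  With \<open>P\<close> read as nonnegativity on \<open>{a<..}\<close>, \<open>derivs n f\<close> is complete monotonicity up to order
  \<open>n\<close>; with \<open>P\<close> read as convergence to \<open>0\<close>, it says that the first \<open>n\<close> derivatives vanish at
  infinity.
\<close>
locale function_cone =
  fixes a :: real and P :: "(real \<Rightarrow> real) \<Rightarrow> bool"
  assumes P_cong: "\<And>f g. (\<And>x. x > a \<Longrightarrow> f x = g x) \<Longrightarrow> P f \<Longrightarrow> P g"
    and P_add: "\<And>f g. P f \<Longrightarrow> P g \<Longrightarrow> P (\<lambda>x. f x + g x)"
    and P_mult: "\<And>f g. P f \<Longrightarrow> P g \<Longrightarrow> P (\<lambda>x. f x * g x)"
begin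

primrec derivs :: "nat \<Rightarrow> (real \<Rightarrow> real) \<Rightarrow> bool" where
  "derivs 0 f \<longleftrightarrow> P f"
| "derivs (Suc n) f \<longleftrightarrow>
     P f \<and> (\<exists>f'. (\<forall>x>a. (f has_real_derivative f' x) (at x)) \<and> derivs n (\<lambda>x. - f' x))"

lemma derivs_imp_P: "derivs n f \<Longrightarrow> P f"
  by (cases n) auto

lemma derivs_SucI:
  assumes "P f" "\<And>x. x > a \<Longrightarrow> (f has_real_derivative f' x) (at x)" "derivs n (\<lambda>x. - f' x)"
  shows "derivs (Suc n) f"
  using assms by auto

lemma derivs_cong:
  assumes "\<And>x. x > a \<Longrightarrow> f x = g x" "derivs n f"
  shows "derivs n g"
proof (cases n)
  case 0
  then show ?thesis using P_cong[of f g] assms by auto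
next
  case (Suc m)
  obtain f' where f': "\<And>x. x > a \<Longrightarrow> (f has_real_derivative f' x) (at x)" "derivs m (\<lambda>x. - f' x)"
    using assms(2) Suc by auto
  have "(g has_real_derivative f' x) (at x)" if "x > a" for x
    by (rule has_field_derivative_transform_within_open[OF f'(1)[OF that], of "{a<..}"])
       (use assms(1) that in auto)
  then show ?thesis
    unfolding Suc using P_cong[of f g] assms derivs_imp_P[OF assms(2)] f'(2)
    by (intro derivs_SucI) auto
qed

lemma derivs_mono: "derivs n f \<Longrightarrow> m \<le> n \<Longrightarrow> derivs m f"
proof (induction n arbitrary: m f)
  case (Suc n)
  show ?case
  proof (cases m)
    case 0
    then show ?thesis using Suc.prems derivs_imp_P by auto
  next
    case (Suc k)
    then show ?thesis using Suc.IH Suc.prems by auto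
  qed
qed auto

text \<open>By uniqueness of derivatives, the witness hidden in \<open>derivs\<close> may be
  exchanged for any known derivative.\<close>

lemma derivs_DERIV:
  assumes "derivs (Suc n) f" "\<And>x. x > a \<Longrightarrow> (f has_real_derivative f' x) (at x)"
  shows "derivs n (\<lambda>x. - f' x)"
proof -
  obtain h where h: "\<And>x. x > a \<Longrightarrow> (f has_real_derivative h x) (at x)" "derivs n (\<lambda>x. - h x)"
    using assms(1) by auto
  show ?thesis
    by (rule derivs_cong[OF _ h(2)]) (use DERIV_unique[OF h(1) assms(2)] in auto)
qed

lemma derivs_add: "derivs n f \<Longrightarrow> derivs n g \<Longrightarrow> derivs n (\<lambda>x. f x + g x)"
proof (induction n arbitrary: f g)
  case (Suc n)
  from Suc.prems obtain f' g' where
    f': "\<And>x. x > a \<Longrightarrow> (f has_real_derivative f' x) (at x)" "derivs n (\<lambda>x. - f' x)" and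
    g': "\<And>x. x > a \<Longrightarrow> (g has_real_derivative g' x) (at x)" "derivs n (\<lambda>x. - g' x)"
    by auto
  have "derivs n (\<lambda>x. - (f' x + g' x))"
    using Suc.IH[OF f'(2) g'(2)] by simp
  then show ?case
    using P_add Suc.prems derivs_imp_P
    by (intro derivs_SucI[where f' = "\<lambda>x. f' x + g' x"]) (auto intro!: derivative_intros f' g')
qed (simp add: P_add)

text \<open>The product rule reads -(f g)' = (-f') g + (-g') f. Because \<open>derivs\<close> steps
  to the negated derivative, every term is again a product of members of the class.\<close>

lemma derivs_mult: "derivs n f \<Longrightarrow> derivs n g \<Longrightarrow> derivs n (\<lambda>x. f x * g x)"
proof (induction n arbitrary: f g)
  case (Suc n)
  from Suc.prems obtain f' g' where
    f': "\<And>x. x > a \<Longrightarrow> (f has_real_derivative f' x) (at x)" "derivs n (\<lambda>x. - f' x)" and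
    g': "\<And>x. x > a \<Longrightarrow> (g has_real_derivative g' x) (at x)" "derivs n (\<lambda>x. - g' x)"
    by auto
  have fg: "derivs n f" "derivs n g"
    using Suc.prems derivs_mono[of "Suc n" _ n] by auto
  have "derivs n (\<lambda>x. - f' x * g x + - g' x * f x)"
    by (intro derivs_add Suc.IH f' g' fg)
  then have *: "derivs n (\<lambda>x. - (f' x * g x + g' x * f x))"
    by simp
  show ?case
    using P_mult Suc.prems derivs_imp_P
    by (intro derivs_SucI[OF _ _ *]) (auto intro!: derivative_eq_intros f' g')
qed (simp add: P_mult)

text \<open>Closure under scaling is a hypothesis here and not a locale axiom, since nonnegativity
  lacks it for negative k; decay at infinity has it for every k.\<close>

lemma derivs_scale:
  assumes "\<And>f. P f \<Longrightarrow> P (\<lambda>x. k * f x)"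
  shows "derivs n f \<Longrightarrow> derivs n (\<lambda>x. k * f x)"
proof (induction n arbitrary: f)
  case (Suc n)
  from Suc.prems obtain f' where
    f': "\<And>x. x > a \<Longrightarrow> (f has_real_derivative f' x) (at x)" "derivs n (\<lambda>x. - f' x)"
    by auto
  have *: "derivs n (\<lambda>x. - (k * f' x))"
    using Suc.IH[OF f'(2)] by simp
  show ?case
    using assms Suc.prems derivs_imp_P
    by (intro derivs_SucI[OF _ _ *]) (auto intro!: derivative_eq_intros f')
qed (simp add: assms)

text \<open>For f x = 1/(x + b) one has -f' = f * f, so each further order is an instance of closure
  under products.\<close>

lemma derivs_inverse_shift:
  assumes "P (\<lambda>x. inverse (x + b))" "a + b \<ge> 0"
  shows "derivs n (\<lambda>x. inverse (x + b))"
proof (induction n)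
  case (Suc n)
  have *: "derivs n (\<lambda>x. - (- (inverse (x + b) * inverse (x + b))))"
    using derivs_mult[OF Suc.IH Suc.IH] by simp
  show ?case
    by (rule derivs_SucI[OF assms(1) _ *])
       (use assms(2) in \<open>auto intro!: derivative_eq_intros simp: power2_eq_square\<close>)
qed (simp add: assms)

end

section \<open>The two instances, and the principle for unit differences\<close>

interpretation nonneg: function_cone a "\<lambda>f. \<forall>x>a. 0 \<le> f x" for a
  by unfold_locales auto

text \<open>The limit at infinity does not depend on \<open>a\<close>, which only fixes the
  half-line where derivatives must exist.\<close>

interpretation vanish: function_cone a "\<lambda>f. (f \<longlongrightarrow> 0) at_top" for a
proof unfold_locales
  fix f g :: "real \<Rightarrow> real"
  assume "\<And>x. x > a \<Longrightarrow> f x = g x" "(f \<longlongrightarrow> 0) at_top"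
  then show "(g \<longlongrightarrow> 0) at_top"
    by (elim Lim_transform_eventually) (auto intro: eventually_mono[OF eventually_gt_at_top[of a]])
qed (auto intro: tendsto_add_zero tendsto_mult_zero)

lemmas vanish_scale = vanish.derivs_scale[OF tendsto_mult_right_zero]

lemma vanish_minus: "vanish.derivs a n f \<Longrightarrow> vanish.derivs a n (\<lambda>x. - f x)"
  using vanish_scale[of a n f "-1"] by simp

lemma vanish_diff:
  "vanish.derivs a n f \<Longrightarrow> vanish.derivs a n g \<Longrightarrow> vanish.derivs a n (\<lambda>x. f x - g x)"
  using vanish.derivs_add[of a n f "\<lambda>x. - g x"] vanish_minus by simp

lemma nonneg_const: "k \<ge> 0 \<Longrightarrow> nonneg.derivs a n (\<lambda>_. k)"
proof (induction n arbitrary: k)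
  case (Suc n)
  have *: "nonneg.derivs a n (\<lambda>x. - 0)"
    using Suc.IH[of 0] by simp
  show ?case
    by (rule nonneg.derivs_SucI[OF _ _ *]) (use Suc.prems in auto)
qed simp

lemma completely_monotonic_on_greaterThanI:
  assumes "\<And>n. nonneg.derivs a n f"
  shows "completely_monotonic_on {a<..} f"
proof -
  \<comment> \<open>\<open>derivs\<close> asserts a finite chain of derivatives for each order
    separately. Iterating h -> -h' through \<open>deriv\<close> yields one sequence for all orders;
    the factors (-1)^k later undo the alternating signs.\<close>
  define E :: "nat \<Rightarrow> real \<Rightarrow> real" where "E k = ((\<lambda>h x. - deriv h x) ^^ k) f" for k
  have E_Suc: "E (Suc k) x = - deriv (E k) x" for k x
    by (simp add: E_def)
  have D: "(h has_real_derivative deriv h x) (at x)" if "nonneg.derivs a (Suc 0) h" "x > a" for h x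
    using that DERIV_imp_deriv by fastforce
  have E: "nonneg.derivs a n (E k)" for n k
  proof (induction k arbitrary: n)
    case (Suc k)
    show ?case
      unfolding E_Suc[abs_def] by (rule nonneg.derivs_DERIV[OF Suc.IH D[OF Suc.IH]])
  qed (simp add: E_def assms)
  have pos: "E k x \<ge> 0" if "x > a" for k x
    using E[of 0 k] that by simp
  have "((\<lambda>x. (-1) ^ k * E k x) has_real_derivative (-1) ^ Suc k * E (Suc k) x) (at x)"
    if "x > a" for k x
    unfolding E_Suc using D[OF E that] by (auto intro!: derivative_eq_intros)
  then show ?thesis
    unfolding completely_monotonic_on_def
    by (intro exI[of _ "\<lambda>k x. (-1) ^ k * E k x"])
       (auto simp: pos has_field_derivative_at_within power_mult_distrib[symmetric]
             simp flip: mult.assoc, auto simp: E_def)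
qed

text \<open>Along x, x + 1, x + 2, ... the values of f decrease to 0, hence are nonnegative. Higher
  orders follow because -f' satisfies the same hypotheses one order lower.\<close>

lemma nonneg_derivs_from_difference:
  "vanish.derivs a n f \<Longrightarrow> nonneg.derivs a n (\<lambda>x. f x - f (x + 1)) \<Longrightarrow> nonneg.derivs a n f"
proof (induction n arbitrary: f)
  case (0 f)
  show ?case
    unfolding nonneg.derivs.simps
  proof (intro allI impI)
    fix x :: real assume x: "x > a"
    have dec: "decseq (\<lambda>k. f (x + real k))"
    proof (rule decseq_SucI)
      fix k
      have "f (x + real k) - f (x + real k + 1) \<ge> 0"
        using 0(2) x by simp
      then show "f (x + real (Suc k)) \<le> f (x + real k)"
        by (simp add: add_ac)
    qed
    have "filterlim (\<lambda>k. x + real k) at_top sequentially"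
      by (intro filterlim_tendsto_add_at_top[OF tendsto_const] filterlim_real_sequentially)
    then have "(\<lambda>k. f (x + real k)) \<longlonglongrightarrow> 0"
      using 0(1) filterlim_compose[of f] by auto
    from decseq_ge[OF dec this, of 0] show "0 \<le> f x" by simp
  qed
next
  case (Suc n f)
  from Suc.prems(1) obtain f' where
    f': "\<And>x. x > a \<Longrightarrow> (f has_real_derivative f' x) (at x)" "vanish.derivs a n (\<lambda>x. - f' x)"
    by auto
  have "((\<lambda>x. f x - f (x + 1)) has_real_derivative f' x - f' (x + 1)) (at x)" if "x > a" for x
    using f'(1)[OF that] f'(1)[of "x + 1"] that
    by (intro derivative_intros) (auto simp: DERIV_shift)
  then have "nonneg.derivs a n (\<lambda>x. - (f' x - f' (x + 1)))"
    using Suc.prems(2) by (rule nonneg.derivs_DERIV[rotated])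
  then have *: "nonneg.derivs a n (\<lambda>x. - f' x)"
    by (intro Suc.IH[OF f'(2)]) simp
  \<comment> \<open>Here the induction hypothesis is applied to f itself, at order n, to obtain its
    nonnegativity.\<close>
  have "nonneg.derivs a 0 f"
    using Suc.IH[of f] vanish.derivs_mono[OF Suc.prems(1), of n]
      nonneg.derivs_mono[OF Suc.prems(2), of n] nonneg.derivs_imp_P by auto
  then show ?case
    by (intro nonneg.derivs_SucI[OF _ f'(1) *]) auto
qed

section \<open>Decay of polygamma functions and digamma differences at infinity\<close>

lemma notin_nonpos_Ints_real: "x > 0 \<Longrightarrow> (x :: real) \<notin> \<int>\<^sub>\<le>\<^sub>0"
  by (auto elim!: nonpos_Ints_cases)

text \<open>Up to sign, \<open>Polygamma n x\<close> is \<open>fact n\<close> times the sum of 1/(x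
  + k)^(n + 1). As n >= 1 and x + k > 1, each term is at most 1/((x + k - 1)(x + k)), and these
  bounds telescope to 1/(x - 1).\<close>

lemma abs_Polygamma_le:
  fixes x :: real
  assumes "n > 0" "x > 1"
  shows "\<bar>Polygamma n x\<bar> \<le> fact n / (x - 1)"
proof -
  define F where "F k = inverse (x - 1 + real k)" for k
  have "filterlim (\<lambda>k. x - 1 + real k) at_top sequentially"
    by (intro filterlim_tendsto_add_at_top[OF tendsto_const] filterlim_real_sequentially)
  then have "F \<longlonglongrightarrow> 0"
    unfolding F_def by (rule tendsto_inverse_0_at_top)
  from telescope_sums'[OF this] have F: "(\<lambda>k. F k - F (Suc k)) sums (F 0 - 0)" .
  have P: "(\<lambda>k. inverse ((x + real k) ^ Suc n)) sums ((-1) ^ Suc n * Polygamma n x / fact n)"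
    using Polygamma_LIMSEQ[of x n] assms by simp
  have le: "inverse ((x + real k) ^ Suc n) \<le> F k - F (Suc k)" for k
  proof -
    have "(x + real k - 1) * (x + real k) \<le> (x + real k) ^ 2"
      using assms by (simp add: power2_eq_square algebra_simps)
    also have "\<dots> \<le> (x + real k) ^ Suc n"
      using assms by (intro power_increasing) auto
    finally have "inverse ((x + real k) ^ Suc n) \<le> inverse ((x + real k - 1) * (x + real k))"
      using assms by (intro le_imp_inverse_le) auto
    also have "\<dots> = F k - F (Suc k)"
      using assms by (simp add: F_def field_simps)
    finally show ?thesis .
  qed
  have "(-1) ^ Suc n * Polygamma n x / fact n \<le> F 0"
    using sums_le[OF le P F] by simp
  moreover have "(-1) ^ Suc n * Polygamma n x / fact n \<ge> 0"
    by (rule sums_le[OF _ sums_zero P]) (use assms in auto)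
  moreover have "\<bar>Polygamma n x\<bar> = fact n * \<bar>(-1) ^ Suc n * Polygamma n x / fact n\<bar>"
    by (simp add: abs_mult power_abs)
  ultimately have "\<bar>Polygamma n x\<bar> \<le> fact n * F 0"
    by (metis abs_of_nonneg fact_ge_zero mult_left_mono)
  then show ?thesis
    by (simp add: F_def divide_inverse)
qed

lemma tendsto_divide_shift_0: "((\<lambda>x. k / (x + b)) \<longlongrightarrow> (0 :: real)) at_top"
proof -
  have "filterlim (\<lambda>x. b + x) at_top (at_top :: real filter)"
    by (intro filterlim_tendsto_add_at_top[OF tendsto_const] filterlim_ident)
  then show ?thesis
    by (intro real_tendsto_divide_at_top[OF tendsto_const]) (simp add: add.commute)
qed

lemma tendsto_Polygamma_shift_0:
  assumes "n > 0"
  shows "((\<lambda>x. Polygamma n (x + b)) \<longlongrightarrow> (0 :: real)) at_top"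
proof (rule Lim_null_comparison)
  show "\<forall>\<^sub>F x in at_top. norm (Polygamma n (x + b)) \<le> fact n / (x + (b - 1))"
    using eventually_gt_at_top[of "1 - b"]
    by eventually_elim (use abs_Polygamma_le[OF assms] in \<open>auto simp: algebra_simps\<close>)
qed (rule tendsto_divide_shift_0)

text \<open>\<open>Digamma\<close> itself grows like a logarithm, so only differences can vanish.
  For s < t the mean value theorem gives t - s times a value of \<open>Polygamma 1\<close>, which
  decays; exchanging s and t only flips the sign.\<close>

lemma tendsto_Digamma_diff_0: "((\<lambda>x. Digamma (x + t) - Digamma (x + s)) \<longlongrightarrow> (0 :: real)) at_top"
proof (induction s t rule: linorder_wlog)
  case (le s t)
  show ?case
  proof (rule Lim_null_comparison)
    show "\<forall>\<^sub>F x in at_top. norm (Digamma (x + t) - Digamma (x + s)) \<le> (t - s) / (x + (s - 1))"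
      using eventually_gt_at_top[of "1 - s"]
    proof eventually_elim
      case (elim x)
      show ?case
      proof (cases "s = t")
        case False
        have "(Digamma has_real_derivative Polygamma 1 y) (at y)" if "y \<ge> x + s" for y
          using has_field_derivative_Polygamma[of y 0 UNIV] notin_nonpos_Ints_real[of y] elim that
          by simp
        then obtain z where z: "z > x + s"
          "Digamma (x + t) - Digamma (x + s) = (x + t - (x + s)) * Polygamma 1 z"
          using MVT2[of "x + s" "x + t" Digamma "Polygamma 1"] False le by auto
        have "\<bar>Polygamma 1 z\<bar> \<le> 1 / (z - 1)"
          using abs_Polygamma_le[of 1 z] z elim by simp
        also have "\<dots> \<le> 1 / (x + (s - 1))"
          using z elim by (intro divide_left_mono) auto
        finally have "(t - s) * \<bar>Polygamma 1 z\<bar> \<le> (t - s) * (1 / (x + (s - 1)))"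
          using le by (intro mult_left_mono) auto
        then show ?thesis
          using le z by (simp add: abs_mult)
      qed auto
    qed
  qed (rule tendsto_divide_shift_0)
next
  case (sym s t)
  from tendsto_minus[OF this] show ?case by simp
qed

lemma vanish_inverse_shift: "a + b \<ge> 0 \<Longrightarrow> vanish.derivs a n (\<lambda>x. inverse (x + b))"
  using tendsto_divide_shift_0[of 1 b] by (intro vanish.derivs_inverse_shift) (auto simp: divide_inverse)

lemma nonneg_inverse_shift: "a + b \<ge> 0 \<Longrightarrow> nonneg.derivs a n (\<lambda>x. inverse (x + b))"
  by (intro nonneg.derivs_inverse_shift) auto

lemma DERIV_Polygamma_shift:
  fixes x :: real
  assumes "x + b > 0"
  shows "((\<lambda>x. Polygamma n (x + b)) has_real_derivative Polygamma (Suc n) (x + b)) (at x)"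
  using has_field_derivative_Polygamma[OF notin_nonpos_Ints_real[OF assms], of n UNIV]
  by (simp add: DERIV_shift)

lemma vanish_Polygamma_shift:
  assumes "a + b \<ge> 0" "m > 0"
  shows "vanish.derivs a n (\<lambda>x. Polygamma m (x + b))"
  using assms(2)
proof (induction n arbitrary: m)
  case (Suc n)
  show ?case
    using assms(1) Suc
    by (intro vanish.derivs_SucI[OF _ DERIV_Polygamma_shift] tendsto_Polygamma_shift_0 vanish_minus)
       auto
qed (simp add: tendsto_Polygamma_shift_0)

text \<open>One differentiation turns the difference into polygamma functions of order 1, which
  vanish together with all their derivatives.\<close>

lemma vanish_Digamma_diff:
  assumes "a + s \<ge> 0" "a + t \<ge> 0"
  shows "vanish.derivs a n (\<lambda>x. Digamma (x + t) - Digamma (x + s))"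
proof (cases n)
  case (Suc m)
  have *: "vanish.derivs a m (\<lambda>x. - (Polygamma (Suc 0) (x + t) - Polygamma (Suc 0) (x + s)))"
    by (intro vanish_minus vanish_diff vanish_Polygamma_shift assms) auto
  show ?thesis
    unfolding Suc
    by (intro vanish.derivs_SucI[OF tendsto_Digamma_diff_0 _ *] DERIV_diff DERIV_Polygamma_shift)
       (use assms in auto)
qed (simp add: tendsto_Digamma_diff_0)

section \<open>The double differencing argument\<close>

text \<open>Keeping \<phi> abstract covers both branches of \<open>Delta\<close>: the scaled digamma
  difference for s < t and \<open>Polygamma 1\<close> for s = t obey the same recurrence. The factor
  e carries the sign, so one argument serves both conclusions.\<close>

lemma square_plus_deriv_nonneg_derivs:
  fixes \<phi> \<phi>' :: "real \<Rightarrow> real" and e s t :: real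
  assumes "s \<le> t"
    and DERIV: "\<And>x. x > -s \<Longrightarrow> (\<phi> has_real_derivative \<phi>' x) (at x)"
    and step: "\<And>x. x > -s \<Longrightarrow> \<phi> (x + 1) = \<phi> x - inverse (x + s) * inverse (x + t)"
    and vanish: "\<And>n. vanish.derivs (-s) n \<phi>"
    and e: "e * (1 - (t - s)\<^sup>2) \<ge> 0"
  shows "nonneg.derivs (-s) n (\<lambda>x. e * ((\<phi> x)\<^sup>2 + \<phi>' x))"
proof -
  define c where "c x = inverse (x + s) * inverse (x + t)" for x
  \<comment> \<open>This is the cofactor of c in the unit difference of \<phi>^2 + \<phi>': the
    squares contribute c (2 \<phi> - c), and the derivatives contribute c times minus the two
    reciprocals.\<close>
  define g where "g x = 2 * \<phi> x - c x - inverse (x + s) - inverse (x + t)" for x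
  have c_nonneg: "nonneg.derivs (-s) n c" for n
    unfolding c_def using assms(1) by (intro nonneg.derivs_mult nonneg_inverse_shift) auto
  have c1_nonneg: "nonneg.derivs (-s) n (\<lambda>x. c (x + 1))" for n
    unfolding c_def add.assoc using assms(1)
    by (intro nonneg.derivs_mult nonneg_inverse_shift) auto
  have g_vanish: "vanish.derivs (-s) n (\<lambda>x. e * g x)" for n
    unfolding g_def c_def using assms(1)
    by (intro vanish_scale vanish_diff vanish vanish.derivs_mult vanish_inverse_shift) auto
  have g_step: "e * g x - e * g (x + 1) = e * (1 - (t - s)\<^sup>2) * (c x * c (x + 1))"
    if "x > -s" for x
  proof -
    have pos: "x + s > 0" "x + t > 0" "x + s + 1 > 0" "x + t + 1 > 0"
      using that assms(1) by auto
    \<comment> \<open>With A = x + s and B = x + t, the numerator over A B (A + 1) (B + 1) is (A +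
      1)(B + 1) + A B - A (A + 1) - B (B + 1) = 1 - (B - A)^2.\<close>
    have "g x - g (x + 1) = (1 - (t - s)\<^sup>2) * (c x * c (x + 1))"
      unfolding g_def step[OF that] c_def using pos
      by (simp add: divide_simps add.commute[of _ 1] add.left_commute[of _ 1])
         (simp add: power2_eq_square algebra_simps)
    then show ?thesis by (simp add: mult.assoc flip: right_diff_distrib)
  qed
  \<comment> \<open>First use of the difference principle; e enters only through the nonnegative
    constant e (1 - (t - s)^2).\<close>
  have g_nonneg: "nonneg.derivs (-s) n (\<lambda>x. e * g x)" for n
    by (rule nonneg_derivs_from_difference[OF g_vanish],
        rule nonneg.derivs_cong[OF g_step[symmetric]])
       (auto intro!: nonneg.derivs_mult nonneg_const c_nonneg c1_nonneg e)
  \<comment> \<open>Differentiating the recurrence of \<phi> gives that of \<phi>', by uniqueness of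
    derivatives and c' = -c (1/(x + s) + 1/(x + t)).\<close>
  have \<phi>'_step: "\<phi>' (x + 1) = \<phi>' x + c x * (inverse (x + s) + inverse (x + t))"
    if "x > -s" for x
  proof -
    have pos: "x + s > 0" "x + t > 0"
      using that assms(1) by auto
    have "((\<lambda>x. \<phi> x - c x) has_real_derivative \<phi>' x + c x * (inverse (x + s) + inverse (x + t))) (at x)"
      unfolding c_def using pos
      by (auto intro!: derivative_eq_intros DERIV that simp: power2_eq_square algebra_simps)
    then have "((\<lambda>x. \<phi> (x + 1)) has_real_derivative
        \<phi>' x + c x * (inverse (x + s) + inverse (x + t))) (at x)"
      by (rule has_field_derivative_transform_within_open[of _ _ _ "{-s<..}"])
         (use that step in \<open>auto simp: c_def\<close>)
    moreover have "((\<lambda>x. \<phi> (x + 1)) has_real_derivative \<phi>' (x + 1)) (at x)"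
      using DERIV[of "x + 1"] that by (simp add: DERIV_shift)
    ultimately show ?thesis
      using DERIV_unique by blast
  qed
  have "vanish.derivs (-s) n (\<lambda>x. - \<phi>' x)"
    using vanish.derivs_DERIV[OF vanish DERIV] by simp
  then have "vanish.derivs (-s) n \<phi>'"
    using vanish_minus by fastforce
  then have "vanish.derivs (-s) n (\<lambda>x. e * ((\<phi> x)\<^sup>2 + \<phi>' x))"
    unfolding power2_eq_square
    by (intro vanish_scale vanish.derivs_add vanish.derivs_mult vanish)
  \<comment> \<open>Second use of the difference principle: the unit difference is the product of c
    and e g, both already handled.\<close>
  moreover have "nonneg.derivs (-s) n
      (\<lambda>x. e * ((\<phi> x)\<^sup>2 + \<phi>' x) - e * ((\<phi> (x + 1))\<^sup>2 + \<phi>' (x + 1)))"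
  proof (rule nonneg.derivs_cong)
    show "nonneg.derivs (-s) n (\<lambda>x. c x * (e * g x))"
      by (intro nonneg.derivs_mult c_nonneg g_nonneg)
    show "c x * (e * g x) = e * ((\<phi> x)\<^sup>2 + \<phi>' x) - e * ((\<phi> (x + 1))\<^sup>2 + \<phi>' (x + 1))"
      if "x > -s" for x
      using that unfolding \<phi>'_step[OF that] step[OF that] g_def c_def[symmetric]
      by (simp add: power2_eq_square algebra_simps)
  qed
  ultimately show ?thesis
    by (rule nonneg_derivs_from_difference)
qed

section \<open>Application to \<open>Delta\<close> and \<open>Theta\<close>\<close>

lemma deriv_Polygamma_real: "x > 0 \<Longrightarrow> deriv (Polygamma n) x = Polygamma (Suc n) (x :: real)"
  by (intro deriv_Polygamma notin_nonpos_Ints_real)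

lemma deriv_deriv_Digamma:
  assumes "x > 0"
  shows "deriv (deriv Digamma) x = Polygamma 2 (x :: real)"
proof -
  have "(Polygamma 1 has_real_derivative Polygamma 2 x) (at x)"
    using has_field_derivative_Polygamma[OF notin_nonpos_Ints_real[OF assms], of 1]
    by (simp add: numeral_2_eq_2)
  then have "(deriv Digamma has_real_derivative Polygamma 2 x) (at x)"
    by (rule has_field_derivative_transform_within_open[of _ _ _ "{0<..}"])
       (use assms in \<open>auto simp: deriv_Polygamma_real\<close>)
  then show ?thesis
    by (rule DERIV_imp_deriv)
qed

text \<open>\<open>Delta\<close> is symmetric in s and t, which reduces the claim to s \<le> t and
  the half-line above -s.\<close>

lemma Delta_nonneg_derivs:
  assumes "e * (1 - (t - s)\<^sup>2) \<ge> 0"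
  shows "nonneg.derivs (- min s t) n (\<lambda>x. e * Delta s t x)"
  using assms
proof (induction s t rule: linorder_wlog)
  case (le s t)
  have min: "min s t = s"
    using le(1) by simp
  show ?case
  proof (cases "s = t")
    case True
    \<comment> \<open>\<open>Polygamma 1\<close> is the limit of the divided difference as t tends
      to s; its recurrence subtracts 1/(x + s)^2, which is the required product at t = s.\<close>
    have "nonneg.derivs (-s) n (\<lambda>x. e * ((Polygamma 1 (x + s))\<^sup>2 + Polygamma 2 (x + s)))"
    proof (rule square_plus_deriv_nonneg_derivs[OF le(1)])
      fix x assume x: "x > -s"
      then show "((\<lambda>x. Polygamma 1 (x + s)) has_real_derivative Polygamma 2 (x + s)) (at x)"
        using DERIV_Polygamma_shift[of x s 1] by (simp add: numeral_2_eq_2)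
      show "Polygamma 1 (x + 1 + s) = Polygamma 1 (x + s) - inverse (x + s) * inverse (x + t)"
        using Polygamma_plus1[of "x + s" 1] x True
        by (simp add: add_ac power2_eq_square divide_inverse)
    qed (use le vanish_Polygamma_shift in auto)
    then show ?thesis
      unfolding min by (rule nonneg.derivs_cong[rotated])
        (use True in \<open>auto simp: Delta_def deriv_Polygamma_real deriv_deriv_Digamma\<close>)
  next
    case False
    define \<phi> where "\<phi> x = inverse (t - s) * (Digamma (x + t) - Digamma (x + s))" for x
    have "nonneg.derivs (-s) n (\<lambda>x. e * ((\<phi> x)\<^sup>2 +
            inverse (t - s) * (Polygamma 1 (x + t) - Polygamma 1 (x + s))))"
    proof (rule square_plus_deriv_nonneg_derivs[OF le(1)])
      fix x assume x: "x > -s"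
      then show "(\<phi> has_real_derivative
          inverse (t - s) * (Polygamma 1 (x + t) - Polygamma 1 (x + s))) (at x)"
        unfolding \<phi>_def One_nat_def using le(1)
        by (intro DERIV_cmult DERIV_diff DERIV_Polygamma_shift) auto
      have pos: "x + s > 0" "x + t > 0" "t - s > 0"
        using x le(1) False by auto
      have "\<phi> (x + 1) = \<phi> x + inverse (t - s) * (inverse (x + t) - inverse (x + s))"
        using Polygamma_plus1[of "x + s" 0] Polygamma_plus1[of "x + t" 0] pos
        by (simp add: \<phi>_def add_ac divide_inverse algebra_simps)
      also have "inverse (x + t) - inverse (x + s) = - (t - s) * (inverse (x + s) * inverse (x + t))"
        using pos by (simp add: field_simps)
      also have "\<phi> x + inverse (t - s) * \<dots> = \<phi> x - inverse (x + s) * inverse (x + t)"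
        using False
        by (simp only: mult_minus_left mult_minus_right mult.assoc[symmetric] left_inverse
              right_minus_eq not_False_eq_True)
      finally show "\<phi> (x + 1) = \<phi> x - inverse (x + s) * inverse (x + t)" .
    next
      show "vanish.derivs (-s) n \<phi>" for n
        unfolding \<phi>_def using le(1) by (intro vanish_scale vanish_Digamma_diff) auto
    qed (use le in auto)
    then show ?thesis
      unfolding min by (rule nonneg.derivs_cong[rotated])
        (use le(1) False in
          \<open>auto simp: Delta_def \<phi>_def deriv_Polygamma_real divide_inverse mult_ac\<close>)
  qed
next
  case (sym s t)
  have "Delta s t x = Delta t s x" for x
  proof -
    have "(a - b) / (t - s) = (b - a) / (s - t)" for a b
      by (metis minus_diff_eq minus_divide_divide)
    then show ?thesis by (auto simp: Delta_def)
  qed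
  then show ?case
    using sym by (simp add: min.commute power2_commute)
qed

text \<open>For s = t both sides are 0, so the identity needs no case restriction.\<close>

lemma Theta_eq_Delta: "Theta s t x = (t - s)\<^sup>2 * Delta s t x"
  by (simp add: Theta_def Delta_def power_divide distrib_left) (simp add: power2_eq_square)

lemma Theta_nonneg_derivs:
  assumes "e * (1 - (t - s)\<^sup>2) \<ge> 0"
  shows "nonneg.derivs (- min s t) n (\<lambda>x. e * Theta s t x)"
proof -
  have "nonneg.derivs (- min s t) n (\<lambda>x. (t - s)\<^sup>2 * (e * Delta s t x))"
    by (intro nonneg.derivs_mult nonneg_const Delta_nonneg_derivs assms) auto
  then show ?thesis
    by (simp add: Theta_eq_Delta mult_ac)
qed

theorem theorem1:
  fixes s t \<alpha> :: real
  assumes "\<alpha> = min s t"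
  shows "(\<bar>t - s\<bar> < 1 \<longrightarrow> completely_monotonic_on {-\<alpha><..} (Delta s t)) \<and>
         (\<bar>t - s\<bar> > 1 \<longrightarrow> completely_monotonic_on {-\<alpha><..} (\<lambda>x. - Delta s t x)) \<and>
         (\<bar>t - s\<bar> < 1 \<longrightarrow> completely_monotonic_on {-\<alpha><..} (Theta s t)) \<and>
         (\<bar>t - s\<bar> > 1 \<longrightarrow> completely_monotonic_on {-\<alpha><..} (\<lambda>x. - Theta s t x))"
proof -
  \<comment> \<open>The sign e is 1 when the distance of s and t is below 1, and -1 when it is above
    1.\<close>
  have small: "1 * (1 - (t - s)\<^sup>2) \<ge> 0" if "\<bar>t - s\<bar> < 1"
    using that by (simp add: abs_square_le_1)
  have large: "-1 * (1 - (t - s)\<^sup>2) \<ge> 0" if "\<bar>t - s\<bar> > 1"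
    using that abs_square_le_1[of "t - s"] by simp
  show ?thesis
    unfolding assms
    using Delta_nonneg_derivs[OF small] Delta_nonneg_derivs[OF large]
      Theta_nonneg_derivs[OF small] Theta_nonneg_derivs[OF large]
    by (auto intro!: completely_monotonic_on_greaterThanI)
qed

end
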